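(* Let $F=\{f_1,\dots,f_k\}$ be a system of tropical polynomials in $n$ variables. (a) Over the semiring $\mathbb{R}$: $F$ has a root in $\mathbb{R}^n$ if and only if the infinite Macaulay tropical linear system $M\odot\vec y$ has a solution over $\mathbb{R}$. (b) Over the semiring $\mathbb{R}_\infty$: $F$ has a root in $\mathbb{R}_\infty^n$ if and only if the infinite non-homogeneous Macaulay tropical linear system $M\odot(0,\vec y)$ has a solution over $\mathbb{R}_\infty$.
   Context: $\mathbb{R}_\infty=\mathbb{R}\cup\{+\infty\}$. Tropical operations on $\mathbb{K}\in\{\mathbb{R},\mathbb{R}_\infty\}$: $x\oplus y=\min\{x,y\}$, $x\odot y=x+y$. A tropical monomial is $m(\vec x)=c\odot \vec x^{I}$ with $c\in\mathbb{K}$, $I=(i_1,\dots,i_n)\in\mathbb{Z}_{\ge0}^n$ and $\vec x^{I}=i_1x_1+\dots+i_nx_n$ in classical notation (with $0\cdot\infty=0$). A tropical polynomial is a finite tropical sum $f=\bigoplus_i m_i=\min_i m_i$ of monomials with pairwise distinct exponent vectors. A point $\vec a\in\mathbb{K}^n$ is a root of $f$ if $\min_i m_i(\vec a)$ is attained on at least two different monomials or is equal to $\infty$. A root of a system is a common root of all its polynomials. Infinite Macaulay matrix: $M$ has columns indexed by $I\in\mathbb{Z}_{\ge0}^n$ and rows indexed by pairs $(j,J)$ with $1\le j\le k$, $J\in\mathbb{Z}_{\ge0}^n$; the entry in row $(j,J)$ and column $I$ is the coefficient of $\vec x^I$ in $\vec x^J\odot f_j$ (equal to $\infty$ if there is no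 such monomial). Each row has only finitely many finite entries. A vector $\vec y=(y_I)_{I\in\mathbb{Z}_{\ge0}^n}$ is a solution of $M\odot\vec y$ if for each row $r$ the minimum $\min_I(m_{r,I}+y_I)$ is attained for at least two different $I$ or equals $\infty$. Over $\mathbb{R}$ all coordinates of $\vec y$ are required to be finite. Over $\mathbb{R}_\infty$, a solution of the non-homogeneous system $M\odot(0,\vec y)$ is a solution with coordinates in $\mathbb{R}_\infty$ whose coordinate corresponding to the column $I=\vec0$ (the constant monomial) equals $0$. *)

theory Defs
  imports "HOL-Analysis.Analysis"
begin

text \<open>
  Tropical scalars are extended reals: tropical addition is \<^term>\<open>min\<close> (\<^term>\<open>Inf\<close> for
  families), tropical multiplication is \<^term>\<open>(+)\<close>, and the two semirings are given by
  their carriers.  The value \<^term>\<open>-\<infinity> :: ereal\<close> belongs to neither.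
\<close>

definition trop_R :: "ereal set"
  where "trop_R = range ereal"

definition trop_R_inf :: "ereal set"
  where "trop_R_inf = - {-\<infinity>}"

text \<open>
  A finite formal sum of monomials with pairwise distinct exponent vectors is a finite partial
  map from exponents to coefficients.  Over \<^term>\<open>trop_R_inf\<close> a monomial may carry the
  coefficient \<^term>\<open>\<infinity> :: ereal\<close>; the empty sum is allowed and has the value
  \<^term>\<open>\<infinity> :: ereal\<close> everywhere.
\<close>

type_synonym 'n trop_poly = "(nat, 'n) vec \<Rightarrow> ereal option"

definition is_trop_poly :: "ereal set \<Rightarrow> 'n::finite trop_poly \<Rightarrow> bool"
  where "is_trop_poly K f \<longleftrightarrow> finite (dom f) \<and> ran f \<subseteq> K"

definition trop_points :: "ereal set \<Rightarrow> (ereal ^ 'n::finite) set"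
  where "trop_points K = {a. \<forall>i. a $ i \<in> K}"

text \<open>The library convention \<^prop>\<open>0 * \<infinity> = (0::ereal)\<close> is the one wanted here.\<close>

definition trop_power :: "ereal ^ 'n \<Rightarrow> nat ^ 'n::finite \<Rightarrow> ereal"
  where "trop_power a I = (\<Sum>i\<in>UNIV. ereal (real (I $ i)) * a $ i)"

definition trop_monom :: "'n::finite trop_poly \<Rightarrow> ereal ^ 'n \<Rightarrow> nat ^ 'n \<Rightarrow> ereal"
  where "trop_monom f a I = the (f I) + trop_power a I"

text \<open>
  Below, the index set is either finite, or all but finitely many of the values are
  \<^term>\<open>\<infinity> :: ereal\<close>, so that the infimum is a minimum.
\<close>

definition trop_vanishes :: "'i set \<Rightarrow> ('i \<Rightarrow> ereal) \<Rightarrow> bool"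
  where "trop_vanishes A v \<longleftrightarrow>
    (\<exists>i\<in>A. \<exists>j\<in>A. i \<noteq> j \<and> v i = (INF l\<in>A. v l) \<and> v j = (INF l\<in>A. v l)) \<or>
    (INF l\<in>A. v l) = \<infinity>"

definition trop_root :: "'n::finite trop_poly \<Rightarrow> ereal ^ 'n \<Rightarrow> bool"
  where "trop_root f a \<longleftrightarrow> trop_vanishes (dom f) (trop_monom f a)"

definition trop_coeff :: "'n::finite trop_poly \<Rightarrow> nat ^ 'n \<Rightarrow> ereal"
  where "trop_coeff f I = (case f I of None \<Rightarrow> \<infinity> | Some c \<Rightarrow> c)"

definition trop_shift :: "nat ^ 'n \<Rightarrow> 'n::finite trop_poly \<Rightarrow> 'n trop_poly"
  where "trop_shift J f = (\<lambda>I. if \<forall>i. J $ i \<le> I $ i then f (I - J) else None)"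
  \<comment> \<open>the product of \<open>f\<close> with the monomial of exponent \<open>J\<close> and coefficient \<open>0\<close>\<close>

definition macaulay :: "(nat \<Rightarrow> 'n::finite trop_poly) \<Rightarrow> nat \<times> (nat ^ 'n) \<Rightarrow> nat ^ 'n \<Rightarrow> ereal"
  where "macaulay F = (\<lambda>(j, J) I. trop_coeff (trop_shift J (F j)) I)"

definition macaulay_rows :: "nat \<Rightarrow> (nat \<times> (nat ^ 'n::finite)) set"
  where "macaulay_rows k = {1..k} \<times> UNIV"

definition trop_linear_solution ::
    "ereal set \<Rightarrow> 'r set \<Rightarrow> ('r \<Rightarrow> 'c \<Rightarrow> ereal) \<Rightarrow> ('c \<Rightarrow> ereal) \<Rightarrow> bool"
  where "trop_linear_solution K R M y \<longleftrightarrow>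
    (\<forall>I. y I \<in> K) \<and> (\<forall>r\<in>R. trop_vanishes UNIV (\<lambda>I. M r I + y I))"

end

theory Submission
  imports Defs
begin

text \<open>
  A root \<open>a\<close> gives the Macaulay solution \<open>y I = trop_power a I\<close>, because the row \<open>(j, J)\<close> evaluates
  at it to the monomials of \<open>f\<^sub>j\<close> at \<open>a\<close>, all shifted by the same number \<open>trop_power a J\<close>.  The
  content is the converse.

  Over the reals (\<open>real_root_of_macaulay_solution\<close>) it is a minimisation argument in the spirit of the
  Canny--Emiris resultant matrices.  Suppose that the \<open>f\<^sub>j\<close> have no common root, and let \<open>G\<close> be the
  sum (tropical product) of the \<open>f\<^sub>j\<close>, perturbed by a strictly concave function; put
  \<open>H p = max\<^sub>b (G b - p \<bullet> b)\<close>, the conjugate of \<open>G\<close>.  For an exponent \<open>p\<close> at which the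
  maximum is attained, say at \<open>a\<close>, some \<open>f\<^sub>j\<close> has a unique minimal monomial \<open>I\<^sub>0\<close> at \<open>a\<close>.  The row
  \<open>(j, p - I\<^sub>0)\<close> of the Macaulay matrix then yields another monomial \<open>I\<close> of \<open>f\<^sub>j\<close> such that
  \<open>q = p - I\<^sub>0 + I\<close> satisfies \<open>c I + y q \<le> c I\<^sub>0 + y p\<close>.  Near \<open>a\<close> the polynomial \<open>f\<^sub>j\<close> is the
  affine function \<open>I\<^sub>0\<close>, so \<open>a\<close> is also the maximiser of \<open>G b - f\<^sub>j b - (p - I\<^sub>0) \<bullet> b\<close>; comparison of
  the two conjugates gives \<open>H q - c I < H p - c I\<^sub>0\<close>.  Hence \<open>y q + H q < y p + H p\<close>, which is
  impossible when \<open>p\<close> minimises \<open>y + H\<close>.  For the minimum to exist, and for \<open>p - I\<^sub>0\<close> to be an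
  exponent, \<open>p\<close> ranges over those exponents for which \<open>G b - p \<bullet> b\<close> decays linearly at infinity:
  there are finitely many, \<open>q\<close> is again one of them, and \<open>I\<^sub>0 < p\<close> holds in every coordinate.

  This argument needs a single finite entry \<open>y p\<close> with \<open>p\<close> large in all coordinates.  Over
  \<open>\<real> \<union> {\<infinity>}\<close> the finite entries of \<open>y\<close> may be unbounded only in the directions of a subset
  \<open>S\<close> of the variables.  For a maximal such \<open>S\<close> and suitable fixed exponents in the other directions
  (\<open>unbounded_stratum\<close>), the entries of \<open>y\<close> on that slice, deep enough in the directions of \<open>S\<close>,
  solve the system from which all variables outside \<open>S\<close> have been deleted.  A real root of that
  system, extended by \<open>\<infinity>\<close> outside \<open>S\<close>, is the required root.
\<close>

section \<open>Strictly concave functions with linear decay\<close>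

text \<open>
  In finite dimension a concave function that tends to \<open>-\<infinity>\<close> at infinity has this property; the
  positive rate \<open>\<epsilon>\<close> is what later gives strict inequalities between exponents.
\<close>

definition decays :: "('a::real_normed_vector \<Rightarrow> real) \<Rightarrow> bool"
  where "decays \<Phi> \<longleftrightarrow> (\<exists>\<epsilon>>0. \<exists>C. \<forall>b. \<Phi> b \<le> C - \<epsilon> * norm b)"

lemma decays_mono:
  assumes "decays \<Psi>" "\<And>b. \<Phi> b \<le> \<Psi> b + K"
  shows "decays \<Phi>"
proof -
  obtain \<epsilon> C where "\<epsilon> > 0" and C: "\<And>b. \<Psi> b \<le> C - \<epsilon> * norm b"
    using assms(1) by (auto simp: decays_def)
  have "\<Phi> b \<le> (C + K) - \<epsilon> * norm b" for b
    using C[of b] assms(2)[of b] by linarith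
  with \<open>\<epsilon> > 0\<close> show ?thesis unfolding decays_def by blast
qed

lemma decays_attains_max:
  fixes \<Phi> :: "'a::euclidean_space \<Rightarrow> real"
  assumes cont: "continuous_on UNIV \<Phi>" and "decays \<Phi>"
  shows "\<exists>a. \<forall>b. \<Phi> b \<le> \<Phi> a"
proof -
  obtain \<epsilon> C where e: "\<epsilon> > 0" and C: "\<And>b. \<Phi> b \<le> C - \<epsilon> * norm b"
    using assms(2) by (auto simp: decays_def)
  define R where "R = max 0 ((C - \<Phi> 0) / \<epsilon>)"
  have "\<exists>a\<in>cball 0 R. \<forall>b\<in>cball 0 R. \<Phi> b \<le> \<Phi> a"
    by (intro continuous_attains_sup continuous_on_subset[OF cont]) (auto simp: R_def)
  then obtain a where a: "\<And>b. norm b \<le> R \<Longrightarrow> \<Phi> b \<le> \<Phi> a"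
    by (metis mem_cball_0)
  have "\<Phi> b \<le> \<Phi> a" for b
  proof (cases "norm b \<le> R")
    case False
    then have "(C - \<Phi> 0) / \<epsilon> < norm b" by (simp add: R_def)
    then have "C - \<Phi> 0 < \<epsilon> * norm b" using e by (simp add: field_simps)
    then have "\<Phi> b \<le> \<Phi> 0" using C[of b] by linarith
    also have "\<dots> \<le> \<Phi> a" by (rule a) (simp add: R_def)
    finally show ?thesis .
  qed (use a in auto)
  then show ?thesis by blast
qed

text \<open>
  Strictness makes a local maximum a strict global one.  It then exceeds the maximum over the unit
  sphere around \<open>a\<close> by some \<open>\<delta> > 0\<close>, and along each ray concavity lets the function fall at
  least as fast from there on, that is with slope \<open>\<delta>\<close>.
\<close>

lemma strict_concave_local_max:
  fixes \<Phi> :: "'a::euclidean_space \<Rightarrow> real"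
  assumes conc: "concave_on UNIV \<Phi>"
    and strict: "\<And>x y. x \<noteq> y \<Longrightarrow> (\<Phi> x + \<Phi> y) / 2 < \<Phi> ((1/2) *\<^sub>R (x + y))"
    and "r > 0" and loc: "\<And>b. dist a b < r \<Longrightarrow> \<Phi> b \<le> \<Phi> a"
  shows "\<And>b. b \<noteq> a \<Longrightarrow> \<Phi> b < \<Phi> a" and "decays \<Phi>"
proof -
  have cvx: "convex_on UNIV (\<lambda>x. - \<Phi> x)"
    using conc by (simp add: concave_on_def)
  have "\<forall>y\<in>UNIV. - \<Phi> a \<le> - \<Phi> y"
    by (rule convex_local_global_minimum[OF \<open>r > 0\<close> cvx]) (auto simp: loc)
  then have glob: "\<Phi> b \<le> \<Phi> a" for b by simp
  show less: "\<Phi> b < \<Phi> a" if "b \<noteq> a" for b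
    using less_le_trans[OF strict[OF that] glob] by simp
  have cont: "continuous_on UNIV \<Phi>"
    using convex_on_continuous[OF open_UNIV cvx] continuous_on_minus by fastforce
  have "\<exists>s\<in>sphere a 1. \<forall>x\<in>sphere a 1. \<Phi> x \<le> \<Phi> s"
    by (intro continuous_attains_sup continuous_on_subset[OF cont]) auto
  then obtain s where s: "dist a s = 1" "\<And>x. dist a x = 1 \<Longrightarrow> \<Phi> x \<le> \<Phi> s"
    by auto
  define \<delta> where "\<delta> = \<Phi> a - \<Phi> s"
  have "\<delta> > 0" using less[of s] s(1) by (cases "s = a") (auto simp: \<delta>_def)
  have far: "\<Phi> b \<le> \<Phi> a + \<delta> - \<delta> * dist a b" for b
  proof (cases "dist a b < 1")
    case True
    then have "\<delta> * dist a b \<le> \<delta> * 1" using \<open>\<delta> > 0\<close> by (intro mult_left_mono) auto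
    then show ?thesis using glob[of b] by linarith
  next
    case False
    define t where "t = 1 / dist a b"
    have "dist a b \<ge> 1" using False by simp
    then have t: "0 < t" "t \<le> 1" "t * dist a b = 1"
      unfolding t_def by (auto simp: divide_le_eq_1)
    have "\<Phi> ((1 - t) *\<^sub>R a + t *\<^sub>R b) \<ge> (1 - t) * \<Phi> a + t * \<Phi> b"
      using convex_onD[OF cvx, of t a b] t by simp
    moreover have "dist a ((1 - t) *\<^sub>R a + t *\<^sub>R b) = 1"
    proof -
      have "a - ((1 - t) *\<^sub>R a + t *\<^sub>R b) = t *\<^sub>R (a - b)" by (simp add: algebra_simps)
      then show ?thesis using t by (simp add: dist_norm)
    qed
    ultimately have "(1 - t) * \<Phi> a + t * \<Phi> b \<le> \<Phi> s" using s(2) by fastforce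
    then have "t * \<Phi> b \<le> t * \<Phi> a - \<delta>" by (simp add: \<delta>_def algebra_simps)
    also have "\<dots> = t * \<Phi> a - \<delta> * (t * dist a b)" using t(3) by simp
    also have "\<dots> = t * (\<Phi> a - \<delta> * dist a b)" by (simp add: algebra_simps)
    finally have "\<Phi> b \<le> \<Phi> a - \<delta> * dist a b" using t(1) by simp
    then show ?thesis using \<open>\<delta> > 0\<close> by linarith
  qed
  have "\<Phi> b \<le> (\<Phi> a + \<delta> + \<delta> * norm a) - \<delta> * norm b" for b
  proof -
    have "norm b \<le> norm a + dist a b" by (metis add.commute dist_norm norm_minus_commute norm_triangle_sub)
    then have "\<delta> * norm b \<le> \<delta> * (norm a + dist a b)" using \<open>\<delta> > 0\<close> by simp
    then show ?thesis using far[of b] by (simp add: algebra_simps)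
  qed
  then show "decays \<Phi>" using \<open>\<delta> > 0\<close> unfolding decays_def by blast
qed

section \<open>Tropical polynomials over the reals and their dual potentials\<close>

definition expo :: "nat ^ 'n \<Rightarrow> real ^ 'n"
  where "expo I = (\<chi> i. real (I $ i))"

lemma expo_nth [simp]: "expo I $ i = real (I $ i)"
  by (simp add: expo_def)

lemma expo_add: "expo (I + J) = expo I + expo J"
  by (simp add: vec_eq_iff)

definition trop_eval :: "(nat ^ 'n::finite) set \<Rightarrow> (nat ^ 'n \<Rightarrow> real) \<Rightarrow> real ^ 'n \<Rightarrow> real"
  where "trop_eval s c b = Min ((\<lambda>I. c I + expo I \<bullet> b) ` s)"

lemma trop_eval_le: "finite s \<Longrightarrow> I \<in> s \<Longrightarrow> trop_eval s c b \<le> c I + expo I \<bullet> b"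
  by (simp add: trop_eval_def)

lemma trop_eval_attained:
  assumes "finite s" "s \<noteq> {}"
  shows "\<exists>I\<in>s. trop_eval s c b = c I + expo I \<bullet> b"
proof -
  have "trop_eval s c b \<in> (\<lambda>I. c I + expo I \<bullet> b) ` s"
    unfolding trop_eval_def using assms by (intro Min_in) auto
  then show ?thesis by auto
qed

lemma trop_eval_eqI:
  assumes "finite s" "I \<in> s" "\<And>L. L \<in> s \<Longrightarrow> c I + expo I \<bullet> b \<le> c L + expo L \<bullet> b"
  shows "trop_eval s c b = c I + expo I \<bullet> b"
  unfolding trop_eval_def using assms by (intro Min_eqI) auto

lemma concave_trop_eval:
  assumes "finite s" "s \<noteq> {}"
  shows "concave_on UNIV (trop_eval s c)"
  unfolding concave_on_def
proof (rule convex_onI)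
  fix t :: real and x y assume t: "0 < t" "t < 1"
  obtain I where I: "I \<in> s" "trop_eval s c ((1 - t) *\<^sub>R x + t *\<^sub>R y) = c I + expo I \<bullet> ((1 - t) *\<^sub>R x + t *\<^sub>R y)"
    using trop_eval_attained[OF assms] by blast
  have "(1 - t) * trop_eval s c x + t * trop_eval s c y
      \<le> (1 - t) * (c I + expo I \<bullet> x) + t * (c I + expo I \<bullet> y)"
    using t trop_eval_le[OF assms(1) I(1)] by (intro add_mono mult_left_mono) auto
  also have "\<dots> = trop_eval s c ((1 - t) *\<^sub>R x + t *\<^sub>R y)"
    unfolding I(2) by (simp add: inner_simps algebra_simps)
  finally show "- trop_eval s c ((1 - t) *\<^sub>R x + t *\<^sub>R y) \<le> (1 - t) * - trop_eval s c x + t * - trop_eval s c y"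
    by simp
qed simp

text \<open>
  The maximum over \<open>b\<close> is the conjugate, at \<open>w\<close>, of the perturbed sum of the polynomials.  The term \<open>norm (1, b)\<close>, which is
  \<open>sqrt (1 + norm b ^ 2)\<close>, supplies strict concavity; since it is bounded by \<open>1 + norm b\<close> it
  changes slopes at infinity by at most \<open>1\<close>.  The set \<open>B\<close> is a parameter so that one polynomial
  can be split off.
\<close>

definition potential ::
    "('j \<Rightarrow> (nat ^ 'n::finite) set) \<Rightarrow> ('j \<Rightarrow> nat ^ 'n \<Rightarrow> real) \<Rightarrow> 'j set \<Rightarrow> real ^ 'n \<Rightarrow> real ^ 'n \<Rightarrow> real"
  where "potential s c B w b = (\<Sum>l\<in>B. trop_eval (s l) (c l) b) - norm (1::real, b) - w \<bullet> b"

text \<open>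
  The Euclidean norm is strictly convex along the affine hyperplane of vectors \<open>(1, b)\<close>, because
  two distinct such vectors are never parallel.
\<close>

lemma norm_one_Pair_midpoint:
  fixes x y :: "'a::real_inner"
  assumes "x \<noteq> y"
  shows "norm (1::real, (1/2) *\<^sub>R (x + y)) < (norm (1::real, x) + norm (1::real, y)) / 2"
proof -
  have "norm ((1::real, x) + (1, y)) \<noteq> norm (1::real, x) + norm (1::real, y)"
  proof
    assume "norm ((1::real, x) + (1, y)) = norm (1::real, x) + norm (1::real, y)"
    then have "norm (1::real, x) *\<^sub>R (1::real, y) = norm (1::real, y) *\<^sub>R (1::real, x)"
      by (simp only: norm_triangle_eq)
    moreover have "norm (1::real, x) \<noteq> 0" by (simp add: zero_prod_def)
    ultimately show False using assms by auto
  qed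
  then have "norm ((1::real, x) + (1, y)) < norm (1::real, x) + norm (1::real, y)"
    using norm_triangle_ineq[of "(1::real, x)" "(1, y)"] by linarith
  moreover have "(1::real, (1/2) *\<^sub>R (x + y)) = (1/2) *\<^sub>R ((1::real, x) + (1, y))"
    by simp
  ultimately show ?thesis by (simp only: norm_scaleR) simp
qed

lemma convex_norm_one_Pair: "convex_on UNIV (\<lambda>b::'a::real_normed_vector. norm (1::real, b))"
proof (rule convex_onI)
  fix t :: real and x y :: 'a assume t: "0 < t" "t < 1"
  have "(1::real, (1 - t) *\<^sub>R x + t *\<^sub>R y) = (1 - t) *\<^sub>R (1, x) + t *\<^sub>R (1, y)" by simp
  also have "norm \<dots> \<le> norm ((1 - t) *\<^sub>R (1::real, x)) + norm (t *\<^sub>R (1::real, y))"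
    by (rule norm_triangle_ineq)
  also have "\<dots> = (1 - t) * norm (1::real, x) + t * norm (1::real, y)"
    using t by (simp only: norm_scaleR real_norm_def abs_of_nonneg less_imp_le diff_gt_0_iff_gt)
  finally show "norm (1::real, (1 - t) *\<^sub>R x + t *\<^sub>R y) \<le> (1 - t) * norm (1::real, x) + t * norm (1::real, y)" .
qed simp

lemma norm_one_Pair_bounds: "norm b \<le> norm (1::real, b)" "norm (1::real, b) \<le> 1 + norm b"
  using norm_snd_le[of b "1::real"] norm_Pair_le[of "1::real" b] by auto

lemma concave_potential:
  fixes s :: "'j \<Rightarrow> (nat ^ 'n::finite) set"
  assumes "\<And>l. l \<in> B \<Longrightarrow> finite (s l) \<and> s l \<noteq> {}"
  shows "concave_on UNIV (potential s c B w)"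
  unfolding concave_on_def
proof (rule convex_onI)
  fix t :: real and x y :: "real ^ 'n" assume t: "0 < t" "t < 1"
  define z where "z = (1 - t) *\<^sub>R x + t *\<^sub>R y"
  have "(1 - t) * trop_eval (s l) (c l) x + t * trop_eval (s l) (c l) y \<le> trop_eval (s l) (c l) z"
    if "l \<in> B" for l
    using convex_onD[OF concave_trop_eval[unfolded concave_on_def], of "s l" t x y "c l"] assms[OF that] t
    by (simp add: z_def)
  then have "(\<Sum>l\<in>B. (1 - t) * trop_eval (s l) (c l) x + t * trop_eval (s l) (c l) y)
      \<le> (\<Sum>l\<in>B. trop_eval (s l) (c l) z)"
    by (rule sum_mono)
  moreover have "norm (1::real, z) \<le> (1 - t) * norm (1::real, x) + t * norm (1::real, y)"
    using convex_onD[OF convex_norm_one_Pair, of t x y] t by (simp add: z_def)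
  moreover have "w \<bullet> z = (1 - t) * (w \<bullet> x) + t * (w \<bullet> y)"
    by (simp add: z_def inner_simps)
  ultimately have "- potential s c B w z \<le> (1 - t) * - potential s c B w x + t * - potential s c B w y"
    by (simp add: potential_def sum.distrib sum_subtractf sum_distrib_left[symmetric] algebra_simps)
  then show "- potential s c B w ((1 - t) *\<^sub>R x + t *\<^sub>R y)
      \<le> (1 - t) * - potential s c B w x + t * - potential s c B w y"
    by (simp add: z_def)
qed simp

lemma strict_concave_potential:
  fixes s :: "'j \<Rightarrow> (nat ^ 'n::finite) set" and x y :: "real ^ 'n"
  assumes "\<And>l. l \<in> B \<Longrightarrow> finite (s l) \<and> s l \<noteq> {}" and "x \<noteq> y"
  shows "(potential s c B w x + potential s c B w y) / 2 < potential s c B w ((1/2) *\<^sub>R (x + y))"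
proof -
  let ?z = "(1/2) *\<^sub>R (x + y)"
  have "(trop_eval (s l) (c l) x + trop_eval (s l) (c l) y) / 2 \<le> trop_eval (s l) (c l) ?z"
    if "l \<in> B" for l
    using convex_onD[OF concave_trop_eval[unfolded concave_on_def], of "s l" "1/2" x y "c l"] assms(1)[OF that]
    by (simp add: scaleR_add_right)
  then have "(\<Sum>l\<in>B. (trop_eval (s l) (c l) x + trop_eval (s l) (c l) y) / 2)
      \<le> (\<Sum>l\<in>B. trop_eval (s l) (c l) ?z)"
    by (rule sum_mono)
  moreover have "(\<Sum>l\<in>B. (trop_eval (s l) (c l) x + trop_eval (s l) (c l) y) / 2)
     = ((\<Sum>l\<in>B. trop_eval (s l) (c l) x) + (\<Sum>l\<in>B. trop_eval (s l) (c l) y)) / 2"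
    by (simp add: sum.distrib sum_divide_distrib[symmetric])
  moreover note norm_one_Pair_midpoint[OF assms(2)]
  moreover have "w \<bullet> ?z = (w \<bullet> x + w \<bullet> y) / 2" by (simp add: inner_simps)
  ultimately show ?thesis by (simp only: potential_def) argo
qed

lemma continuous_potential:
  fixes s :: "'j \<Rightarrow> (nat ^ 'n::finite) set"
  assumes "\<And>l. l \<in> B \<Longrightarrow> finite (s l) \<and> s l \<noteq> {}"
  shows "continuous_on UNIV (potential s c B w)"
proof -
  have "continuous_on UNIV (\<lambda>b. - potential s c B w b)"
    using concave_potential[of B s c w] assms by (intro convex_on_continuous) (auto simp: concave_on_def)
  then show ?thesis using continuous_on_minus by fastforce
qed

lemma potential_split:
  assumes "finite A" "j \<in> A"
  shows "potential s c A w b = trop_eval (s j) (c j) b - u \<bullet> b + potential s c (A - {j}) (w - u) b"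
  using assms by (simp add: potential_def sum.remove[OF assms] inner_simps)

text \<open>
  Exponents are nonnegative and bounded: along a positive coordinate axis a tropical polynomial is
  bounded below, and along a negative one it decreases at most linearly.
\<close>

lemma trop_eval_axis_ge:
  assumes "finite s" "s \<noteq> {}"
  shows "\<exists>K D. \<forall>i. \<forall>t\<ge>0. trop_eval s c (t *\<^sub>R axis i 1) \<ge> - K
      \<and> trop_eval s c (- t *\<^sub>R axis i 1) \<ge> - K - D * t"
proof -
  define K where "K = (\<Sum>I\<in>s. \<bar>c I\<bar>)"
  define D where "D = (\<Sum>I\<in>s. \<Sum>i\<in>UNIV. real (I $ i))"
  have K: "- K \<le> c I" if "I \<in> s" for I
    using member_le_sum[of I s "\<lambda>I. \<bar>c I\<bar>"] that assms by (auto simp: K_def)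
  have D: "real (I $ i) \<le> D" if "I \<in> s" for I i
  proof -
    have "real (I $ i) \<le> (\<Sum>i\<in>UNIV. real (I $ i))" by (rule member_le_sum) auto
    also have "\<dots> \<le> D" unfolding D_def
      by (rule member_le_sum[of I s "\<lambda>I. \<Sum>i\<in>UNIV. real (I $ i)"]) (use that assms in \<open>auto intro: sum_nonneg\<close>)
    finally show ?thesis .
  qed
  have "trop_eval s c (t *\<^sub>R axis i 1) \<ge> - K \<and> trop_eval s c (- t *\<^sub>R axis i 1) \<ge> - K - D * t"
    if "t \<ge> 0" for t i
  proof
    obtain I where "I \<in> s" "trop_eval s c (t *\<^sub>R axis i 1) = c I + t * real (I $ i)"
      using trop_eval_attained[OF assms, of c "t *\<^sub>R axis i 1"] by (auto simp: inner_axis)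
    then show "trop_eval s c (t *\<^sub>R axis i 1) \<ge> - K"
      using K[of I] mult_nonneg_nonneg[OF that, of "real (I $ i)"] by linarith
    obtain I where I: "I \<in> s" "trop_eval s c (- t *\<^sub>R axis i 1) = c I - t * real (I $ i)"
      using trop_eval_attained[OF assms, of c "- t *\<^sub>R axis i 1"] by (auto simp: inner_axis)
    have "t * real (I $ i) \<le> D * t"
      using mult_left_mono[OF D[OF I(1), of i] that] by (simp add: mult.commute)
    then show "trop_eval s c (- t *\<^sub>R axis i 1) \<ge> - K - D * t"
      using K[OF I(1)] I(2) by linarith
  qed
  then show ?thesis by blast
qed

lemma sum_trop_eval_axis_ge:
  assumes "finite B" "\<And>l. l \<in> B \<Longrightarrow> finite (s l) \<and> s l \<noteq> {}"
  shows "\<exists>K D. \<forall>i. \<forall>t\<ge>0. (\<Sum>l\<in>B. trop_eval (s l) (c l) (t *\<^sub>R axis i 1)) \<ge> - K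
      \<and> (\<Sum>l\<in>B. trop_eval (s l) (c l) (- t *\<^sub>R axis i 1)) \<ge> - K - D * t"
proof -
  have "\<forall>l\<in>B. \<exists>K D. \<forall>i. \<forall>t\<ge>0. trop_eval (s l) (c l) (t *\<^sub>R axis i 1) \<ge> - K
      \<and> trop_eval (s l) (c l) (- t *\<^sub>R axis i 1) \<ge> - K - D * t"
    using assms(2) trop_eval_axis_ge by blast
  then obtain K D where KD: "\<And>l i t. l \<in> B \<Longrightarrow> t \<ge> 0 \<Longrightarrow> trop_eval (s l) (c l) (t *\<^sub>R axis i 1) \<ge> - K l
      \<and> trop_eval (s l) (c l) (- t *\<^sub>R axis i 1) \<ge> - K l - D l * t"
    by metis
  have "(\<Sum>l\<in>B. trop_eval (s l) (c l) (t *\<^sub>R axis i 1)) \<ge> - sum K B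
      \<and> (\<Sum>l\<in>B. trop_eval (s l) (c l) (- t *\<^sub>R axis i 1)) \<ge> - sum K B - sum D B * t"
    if "t \<ge> 0" for i t
  proof -
    have "(\<Sum>l\<in>B. - K l) \<le> (\<Sum>l\<in>B. trop_eval (s l) (c l) (t *\<^sub>R axis i 1))"
      "(\<Sum>l\<in>B. - K l - D l * t) \<le> (\<Sum>l\<in>B. trop_eval (s l) (c l) (- t *\<^sub>R axis i 1))"
      using KD that by (auto intro!: sum_mono)
    then show ?thesis by (simp add: sum_negf sum_subtractf sum_distrib_right)
  qed
  then show ?thesis by blast
qed

lemma slope_le:
  fixes x y C :: real
  assumes "\<And>t. t \<ge> 0 \<Longrightarrow> t * x \<le> C + t * y"
  shows "x \<le> y"
proof (rule ccontr)
  assume "\<not> x \<le> y"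
  then have "x - y > 0" by simp
  define t where "t = (\<bar>C\<bar> + 1) / (x - y)"
  have "t \<ge> 0" using \<open>x - y > 0\<close> by (simp add: t_def)
  moreover have "t * (x - y) = \<bar>C\<bar> + 1" using \<open>x - y > 0\<close> by (simp add: t_def)
  ultimately show False using assms[of t] by (simp add: algebra_simps)
qed

text \<open>
  Along the positive \<open>i\<close>-axis the polynomials are bounded below, and the slope at least \<open>1\<close> of
  the linear form of \<open>m\<close> compensates the norm, so only \<open>- x $ i\<close> is left to cause the decay.  This is what
  keeps the row indices of the Macaulay matrix nonnegative.
\<close>

lemma decays_potential_pos:
  fixes s :: "'j \<Rightarrow> (nat ^ 'n::finite) set" and x m :: "real ^ 'n"
  assumes "finite B" "\<And>l. l \<in> B \<Longrightarrow> finite (s l) \<and> s l \<noteq> {}"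
    and "decays (potential s c B (x - m))" and "m $ i \<ge> 1"
  shows "x $ i > 0"
proof -
  obtain \<epsilon> C where e: "\<epsilon> > 0" and C: "\<And>b. potential s c B (x - m) b \<le> C - \<epsilon> * norm b"
    using assms(3) by (auto simp: decays_def)
  obtain K where K: "\<And>t. t \<ge> 0 \<Longrightarrow> (\<Sum>l\<in>B. trop_eval (s l) (c l) (t *\<^sub>R axis i 1)) \<ge> - K"
    using sum_trop_eval_axis_ge[of B s c] assms(1,2) by blast
  have "\<epsilon> \<le> x $ i"
  proof (rule slope_le)
    fix t :: real assume t: "t \<ge> 0"
    have "norm (1::real, t *\<^sub>R axis i 1 :: real ^ 'n) \<le> 1 + t"
      using norm_one_Pair_bounds(2)[of "t *\<^sub>R axis i 1 :: real ^ 'n"] t by simp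
    moreover have "potential s c B (x - m) (t *\<^sub>R axis i 1) \<le> C - \<epsilon> * t"
      using C[of "t *\<^sub>R axis i 1"] t by simp
    moreover have "(x - m) \<bullet> (t *\<^sub>R axis i 1) = t * x $ i - t * m $ i"
      by (simp add: inner_axis algebra_simps)
    moreover have "t * m $ i \<ge> t * 1" using t assms(4) by (intro mult_left_mono)
    ultimately have "- K - (1 + t) - (t * x $ i - t) \<le> C - \<epsilon> * t"
      using K[OF t] by (simp add: potential_def)
    then show "t * \<epsilon> \<le> (C + K + 1) + t * x $ i" by (simp add: mult.commute)
  qed
  with e show ?thesis by linarith
qed

text \<open>
  Along a negative axis a large \<open>w $ i\<close> would outweigh the at most linear decrease of the other
  terms.
\<close>

lemma decays_potential_bounded:
  fixes s :: "'j \<Rightarrow> (nat ^ 'n::finite) set"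
  assumes "finite B" "\<And>l. l \<in> B \<Longrightarrow> finite (s l) \<and> s l \<noteq> {}"
  shows "\<exists>U. \<forall>w i. decays (potential s c B w) \<longrightarrow> w $ i \<le> U"
proof -
  obtain K D where K: "\<And>t i. t \<ge> 0 \<Longrightarrow> (\<Sum>l\<in>B. trop_eval (s l) (c l) (- t *\<^sub>R axis i 1)) \<ge> - K - D * t"
    using sum_trop_eval_axis_ge[of B s c] assms by blast
  have "w $ i \<le> D + 1" if dec: "decays (potential s c B w)" for w i
  proof -
    obtain \<epsilon> C where e: "\<epsilon> > 0" and C: "\<And>b. potential s c B w b \<le> C - \<epsilon> * norm b"
      using dec by (auto simp: decays_def)
    show ?thesis
    proof (rule slope_le)
      fix t :: real assume t: "t \<ge> 0"
      have "norm (1::real, - t *\<^sub>R axis i 1 :: real ^ 'n) \<le> 1 + t"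
        using norm_one_Pair_bounds(2)[of "- t *\<^sub>R axis i 1 :: real ^ 'n"] t by simp
      moreover have "potential s c B w (- t *\<^sub>R axis i 1) \<le> C - \<epsilon> * t"
        using C[of "- t *\<^sub>R axis i 1"] t by simp
      moreover have "w \<bullet> (- t *\<^sub>R axis i 1) = - (t * w $ i)"
        by (simp add: inner_axis)
      moreover have "\<epsilon> * t \<ge> 0" using e t by simp
      ultimately have "- K - D * t - (1 + t) + t * w $ i \<le> C"
        using K[OF t, of i] by (simp add: potential_def inner_axis)
      then show "t * w $ i \<le> (C + K + 1) + t * (D + 1)" by (simp add: algebra_simps)
    qed
  qed
  then show ?thesis by blast
qed

lemma finite_bounded_exponents: "finite {p :: nat ^ 'n::finite. \<forall>i. p $ i \<le> N}"
proof -
  have "finite (vec_lambda ` ((UNIV :: 'n set) \<rightarrow>\<^sub>E {..N}))"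
    by (intro finite_imageI finite_PiE) auto
  moreover have "{p :: nat ^ 'n. \<forall>i. p $ i \<le> N} \<subseteq> vec_lambda ` ((UNIV :: 'n set) \<rightarrow>\<^sub>E {..N})"
    by (auto intro!: image_eqI[of _ vec_lambda "vec_nth _"])
  ultimately show ?thesis by (rule rev_finite_subset)
qed

section \<open>Macaulay solutions with finite entries give finite roots\<close>

text \<open>
  The minimisation argument.  The solution property is used in the form that no finite entry of a
  row is its unique minimum.  The hypothesis on \<open>p0\<close> puts this exponent into the finite
  set over which \<open>y + H\<close> is minimised.
\<close>

lemma real_root_of_macaulay_solution:
  fixes s :: "'j \<Rightarrow> (nat ^ 'n::finite) set" and c :: "'j \<Rightarrow> nat ^ 'n \<Rightarrow> real" and y :: "nat ^ 'n \<Rightarrow> ereal"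
  assumes A: "finite A" and s: "\<And>l. l \<in> A \<Longrightarrow> finite (s l) \<and> s l \<noteq> {}"
    and y: "\<And>p. y p \<noteq> -\<infinity>"
    and sol: "\<And>j I J. j \<in> A \<Longrightarrow> I \<in> s j \<Longrightarrow> y (I + J) \<noteq> \<infinity> \<Longrightarrow>
        \<exists>I'\<in>s j. I' \<noteq> I \<and> ereal (c j I') + y (I' + J) \<le> ereal (c j I) + y (I + J)"
    and p0: "y p0 \<noteq> \<infinity>" and e: "\<And>l. l \<in> A \<Longrightarrow> e l \<in> s l"
    and large: "\<And>i. (\<Sum>l\<in>A. e l $ i) < p0 $ i"
  shows "\<exists>b. \<forall>j\<in>A. \<forall>I\<in>s j. \<exists>I'\<in>s j. I' \<noteq> I \<and> c j I' + expo I' \<bullet> b \<le> c j I + expo I \<bullet> b"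
proof (rule ccontr)
  assume "\<not> ?thesis"
  then have noroot: "\<exists>j\<in>A. \<exists>I\<in>s j. \<forall>I'\<in>s j. I' \<noteq> I \<longrightarrow> c j I + expo I \<bullet> b < c j I' + expo I' \<bullet> b" for b
    by (meson not_le)
  \<comment> \<open>With this shift the linear form at \<open>p0\<close> is a sum of one exponent from each polynomial, so it
    cancels against the polynomials and leaves the decay of \<open>- norm (1, b)\<close>.\<close>
  define m where "m = expo p0 - (\<Sum>l\<in>A. expo (e l))"
  have m: "m $ i \<ge> 1" for i
  proof -
    have "real (\<Sum>l\<in>A. e l $ i) + 1 \<le> real (p0 $ i)" using large[of i] by linarith
    then show ?thesis by (simp add: m_def)
  qed
  define E where "E = {p. decays (potential s c A (expo p - m))}"
  have "finite E"
  proof -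
    obtain U where U: "\<And>w i. decays (potential s c A w) \<Longrightarrow> w $ i \<le> U"
      using decays_potential_bounded[of A s c] A s by blast
    define N where "N = nat \<lceil>U + (\<Sum>i\<in>UNIV. \<bar>m $ i\<bar>)\<rceil>"
    have "p $ i \<le> N" if "p \<in> E" for p i
    proof -
      have "real (p $ i) \<le> U + m $ i" using U[of "expo p - m" i] that by (simp add: E_def)
      moreover have "m $ i \<le> (\<Sum>i\<in>UNIV. \<bar>m $ i\<bar>)"
        using member_le_sum[of i UNIV "\<lambda>i. \<bar>m $ i\<bar>"] by simp
      ultimately show ?thesis unfolding N_def by linarith
    qed
    then have "E \<subseteq> {p. \<forall>i. p $ i \<le> N}" by blast
    then show ?thesis using finite_bounded_exponents by (rule finite_subset)
  qed
  have "p0 \<in> E"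
  proof -
    have "potential s c A (expo p0 - m) b \<le> (\<Sum>l\<in>A. c l (e l)) - 1 * norm b" for b
    proof -
      have "(\<Sum>l\<in>A. trop_eval (s l) (c l) b) \<le> (\<Sum>l\<in>A. c l (e l) + expo (e l) \<bullet> b)"
        using s e by (intro sum_mono trop_eval_le) auto
      also have "\<dots> = (\<Sum>l\<in>A. c l (e l)) + (expo p0 - m) \<bullet> b"
        by (simp add: m_def sum.distrib inner_sum_left)
      finally show ?thesis
        using norm_one_Pair_bounds(1)[of b] by (simp add: potential_def)
    qed
    then show ?thesis unfolding E_def decays_def using zero_less_one by blast
  qed
  have "\<forall>p\<in>E. \<exists>a. \<forall>b. potential s c A (expo p - m) b \<le> potential s c A (expo p - m) a"
    unfolding E_def using decays_attains_max continuous_potential[of A s c] s by blast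
  then obtain a where a: "\<And>p b. p \<in> E \<Longrightarrow>
      potential s c A (expo p - m) b \<le> potential s c A (expo p - m) (a p)"
    by metis
  define H where "H p = potential s c A (expo p - m) (a p)" for p
  define E' where "E' = {p \<in> E. y p \<noteq> \<infinity>}"
  have "finite E'" "E' \<noteq> {}"
    using \<open>finite E\<close> \<open>p0 \<in> E\<close> p0 by (auto simp: E'_def)
  then obtain p where p: "p \<in> E'"
    and p_min: "\<And>q. q \<in> E' \<Longrightarrow> real_of_ereal (y p) + H p \<le> real_of_ereal (y q) + H q"
    using ex_min_if_finite[of "(\<lambda>p. real_of_ereal (y p) + H p) ` E'"]
    by (smt (verit, best) arg_min_if_finite(1) arg_min_least)
  obtain j I0 where j: "j \<in> A" and I0: "I0 \<in> s j"
    and uniq: "\<And>I. I \<in> s j \<Longrightarrow> I \<noteq> I0 \<Longrightarrow> c j I0 + expo I0 \<bullet> a p < c j I + expo I \<bullet> a p"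
    using noroot[of "a p"] by blast
  have fin: "finite (s j)" using s j by blast
  \<comment> \<open>\<open>?\<Psi>\<close> is the potential of the other polynomials; it is common to the potentials of \<open>p\<close> and
    of every exponent \<open>q\<close> obtained from \<open>p\<close> by exchanging \<open>I0\<close> for another monomial of
    polynomial \<open>j\<close>.\<close>
  define v where "v = expo p - m - expo I0"
  let ?\<Psi> = "potential s c (A - {j}) v"
  have sB: "\<And>l. l \<in> A - {j} \<Longrightarrow> finite (s l) \<and> s l \<noteq> {}" using s by blast
  have split_p: "potential s c A (expo p - m) b = trop_eval (s j) (c j) b - expo I0 \<bullet> b + ?\<Psi> b" for b
    unfolding v_def by (rule potential_split[OF A j])
  have eval_p: "trop_eval (s j) (c j) (a p) = c j I0 + expo I0 \<bullet> a p"
    by (rule trop_eval_eqI[OF fin I0]) (use uniq less_imp_le in blast)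
  \<comment> \<open>Near \<open>a p\<close> the monomial \<open>I0\<close> stays the minimum, so there the potential of \<open>p\<close> differs
    from \<open>?\<Psi>\<close> by a constant and \<open>?\<Psi>\<close> inherits the local maximum.\<close>
  have "\<forall>\<^sub>F b in nhds (a p). \<forall>I\<in>s j - {I0}. c j I0 + expo I0 \<bullet> b < c j I + expo I \<bullet> b"
  proof (rule eventually_ball_finite)
    show "\<forall>I\<in>s j - {I0}. \<forall>\<^sub>F b in nhds (a p). c j I0 + expo I0 \<bullet> b < c j I + expo I \<bullet> b"
    proof
      fix I assume I: "I \<in> s j - {I0}"
      have "open {b. c j I0 + expo I0 \<bullet> b < c j I + expo I \<bullet> b}"
        by (intro open_Collect_less continuous_intros)
      then show "\<forall>\<^sub>F b in nhds (a p). c j I0 + expo I0 \<bullet> b < c j I + expo I \<bullet> b"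
        using uniq[of I] I by (auto simp: eventually_nhds)
    qed
  qed (use fin in auto)
  then obtain r where r: "r > 0" and near: "\<And>b. dist b (a p) < r \<Longrightarrow> 
      \<forall>I\<in>s j - {I0}. c j I0 + expo I0 \<bullet> b < c j I + expo I \<bullet> b"
    by (auto simp: eventually_nhds_metric)
  have loc: "?\<Psi> b \<le> ?\<Psi> (a p)" if "dist (a p) b < r" for b
  proof -
    have "c j I0 + expo I0 \<bullet> b \<le> c j L + expo L \<bullet> b" if "L \<in> s j" for L
      using near[of b] \<open>dist (a p) b < r\<close> that by (cases "L = I0") (auto simp: dist_commute less_imp_le)
    then have "trop_eval (s j) (c j) b = c j I0 + expo I0 \<bullet> b"
      by (rule trop_eval_eqI[OF fin I0])
    then show ?thesis using a[of p b] p eval_p by (simp add: split_p E'_def)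
  qed
  have less: "\<And>b. b \<noteq> a p \<Longrightarrow> ?\<Psi> b < ?\<Psi> (a p)" and dec: "decays ?\<Psi>"
    using strict_concave_local_max[OF concave_potential strict_concave_potential r loc] sB
    by blast+
  have "I0 $ i < p $ i" for i
  proof -
    have "decays (potential s c (A - {j}) ((expo p - expo I0) - m))"
      using dec by (simp add: v_def algebra_simps)
    then have "(expo p - expo I0) $ i > 0"
      using decays_potential_pos[of "A - {j}" s c "expo p - expo I0" m i] A m sB by simp
    then show ?thesis by simp
  qed
  then have pJ: "p = I0 + (p - I0)"
    by (simp add: vec_eq_iff less_imp_le)
  obtain I where I: "I \<in> s j" "I \<noteq> I0"
    and yI: "ereal (c j I) + y (I + (p - I0)) \<le> ereal (c j I0) + y p"
    using sol[OF j I0, of "p - I0"] p pJ by (auto simp: E'_def)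
  define q where "q = I + (p - I0)"
  have "expo p = expo I0 + expo (p - I0)" using pJ expo_add by metis
  then have split_q: "potential s c A (expo q - m) b = trop_eval (s j) (c j) b - expo I \<bullet> b + ?\<Psi> b" for b
    using potential_split[OF A j, of s c "expo q - m" b "expo I"]
    by (simp add: q_def v_def expo_add algebra_simps)
  have "y p \<noteq> \<infinity>" using p by (simp add: E'_def)
  then obtain yp where yp: "y p = ereal yp" using y[of p] by (cases "y p") auto
  then obtain yq where yq: "y q = ereal yq" using y[of q] yI by (cases "y q") (auto simp: q_def)
  have "potential s c A (expo q - m) b \<le> ?\<Psi> b + c j I" for b
    using trop_eval_le[OF fin I(1), of "c j" b] by (simp add: split_q)
  then have "q \<in> E" using decays_mono[OF dec] by (auto simp: E_def)
  then have qE: "q \<in> E'" using yq by (simp add: E'_def)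
  \<comment> \<open>Strict in both cases: by uniqueness of \<open>I0\<close> if the maximisers agree, and by strict concavity
    otherwise.\<close>
  have "H q < c j I + ?\<Psi> (a p)"
  proof (cases "a q = a p")
    case True
    then show ?thesis using uniq[OF I] by (simp add: H_def split_q eval_p)
  next
    case False
    then show ?thesis
      using less[OF False] trop_eval_le[OF fin I(1), of "c j" "a q"] by (simp add: H_def split_q)
  qed
  moreover have "H p = c j I0 + ?\<Psi> (a p)" by (simp add: H_def split_p eval_p)
  moreover have "c j I + yq \<le> c j I0 + yp" using yI yp yq by (simp add: q_def)
  ultimately show False using p_min[OF qE] yp yq by simp
qed

section \<open>Roots and Macaulay solutions over the extended reals\<close>

text \<open>
  Vanishing means that no finite entry is the unique minimum.  In this form the condition speaks
  about individual entries and not about the infimum.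
\<close>

lemma trop_vanishes_iff:
  assumes fin: "finite {P \<in> A. v P \<noteq> \<infinity>}"
  shows "trop_vanishes A v \<longleftrightarrow> (\<forall>P\<in>A. v P \<noteq> \<infinity> \<longrightarrow> (\<exists>Q\<in>A. Q \<noteq> P \<and> v Q \<le> v P))"
proof
  assume van: "trop_vanishes A v"
  show "\<forall>P\<in>A. v P \<noteq> \<infinity> \<longrightarrow> (\<exists>Q\<in>A. Q \<noteq> P \<and> v Q \<le> v P)"
  proof (intro ballI impI)
    fix P assume P: "P \<in> A" "v P \<noteq> \<infinity>"
    have le: "(INF l\<in>A. v l) \<le> v P" using P(1) by (rule INF_lower)
    then have "(INF l\<in>A. v l) \<noteq> \<infinity>" using P(2) by auto
    then obtain i j where "i \<in> A" "j \<in> A" "i \<noteq> j" "v i = (INF l\<in>A. v l)" "v j = (INF l\<in>A. v l)"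
      using van by (auto simp: trop_vanishes_def)
    then show "\<exists>Q\<in>A. Q \<noteq> P \<and> v Q \<le> v P" using le by metis
  qed
next
  assume weak: "\<forall>P\<in>A. v P \<noteq> \<infinity> \<longrightarrow> (\<exists>Q\<in>A. Q \<noteq> P \<and> v Q \<le> v P)"
  show "trop_vanishes A v"
  proof (cases "{P \<in> A. v P \<noteq> \<infinity>} = {}")
    case True
    then have "(INF l\<in>A. v l) = \<infinity>" by (intro antisym INF_greatest) auto
    then show ?thesis by (simp add: trop_vanishes_def)
  next
    case False
    then obtain P where P: "P \<in> A" "v P \<noteq> \<infinity>"
      and min: "\<And>Q. Q \<in> A \<Longrightarrow> v Q \<noteq> \<infinity> \<Longrightarrow> v P \<le> v Q"
      using arg_min_if_finite(1)[OF fin False, of v] arg_min_least[OF fin False, of _ v] by blast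
    have min': "v P \<le> v Q" if "Q \<in> A" for Q
      using min[OF that] by (cases "v Q = \<infinity>") auto
    have INF: "(INF l\<in>A. v l) = v P"
      using P(1) min' by (intro antisym INF_lower INF_greatest)
    obtain Q where "Q \<in> A" "Q \<noteq> P" "v Q \<le> v P" using weak P by blast
    then show ?thesis using INF P(1) min' unfolding trop_vanishes_def by (metis antisym)
  qed
qed

lemma trop_root_iff:
  assumes "finite (dom f)"
  shows "trop_root f a \<longleftrightarrow> (\<forall>I\<in>dom f. trop_monom f a I \<noteq> \<infinity> \<longrightarrow>
    (\<exists>I'\<in>dom f. I' \<noteq> I \<and> trop_monom f a I' \<le> trop_monom f a I))"
  unfolding trop_root_def using assms by (intro trop_vanishes_iff) simp

lemma macaulay_shift: "macaulay F (j, J) (I + J) = trop_coeff (F j) I"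
  by (simp add: macaulay_def trop_coeff_def trop_shift_def)

lemma macaulay_finite_entry:
  assumes "macaulay F (j, J) P \<noteq> \<infinity>"
  obtains I where "I \<in> dom (F j)" "P = I + J"
proof
  from assms have le: "\<forall>i. J $ i \<le> P $ i" and "F j (P - J) \<noteq> None"
    by (auto simp: macaulay_def trop_coeff_def trop_shift_def split: if_splits option.splits)
  then show "P - J \<in> dom (F j)" by auto
  show "P = P - J + J" using le by (simp add: vec_eq_iff)
qed

lemma macaulay_row_vanishes_iff:
  assumes "finite (dom (F j))" and y: "\<And>p. y p \<noteq> -\<infinity>"
  shows "trop_vanishes UNIV (\<lambda>P. macaulay F (j, J) P + y P) \<longleftrightarrow>
    (\<forall>I\<in>dom (F j). the (F j I) + y (I + J) \<noteq> \<infinity> \<longrightarrow>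
      (\<exists>I'\<in>dom (F j). I' \<noteq> I \<and> the (F j I') + y (I' + J) \<le> the (F j I) + y (I + J)))"
    (is "_ \<longleftrightarrow> ?R")
proof -
  let ?v = "\<lambda>P. macaulay F (j, J) P + y P"
  have v: "?v (I + J) = the (F j I) + y (I + J)" if "I \<in> dom (F j)" for I
    using that by (auto simp: macaulay_shift trop_coeff_def)
  have supp: "\<exists>I\<in>dom (F j). P = I + J" if "?v P \<noteq> \<infinity>" for P
  proof -
    have "macaulay F (j, J) P \<noteq> \<infinity>" using that by auto
    then show ?thesis by (rule macaulay_finite_entry) blast
  qed
  have "finite {P \<in> UNIV. ?v P \<noteq> \<infinity>}"
    by (rule finite_subset[of _ "(\<lambda>I. I + J) ` dom (F j)"]) (use supp assms in blast)+
  then have "trop_vanishes UNIV ?v \<longleftrightarrow> (\<forall>P. ?v P \<noteq> \<infinity> \<longrightarrow> (\<exists>Q. Q \<noteq> P \<and> ?v Q \<le> ?v P))"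
    by (subst trop_vanishes_iff) auto
  also have "\<dots> \<longleftrightarrow> ?R"
  proof
    assume L: "\<forall>P. ?v P \<noteq> \<infinity> \<longrightarrow> (\<exists>Q. Q \<noteq> P \<and> ?v Q \<le> ?v P)"
    show ?R
    proof (intro ballI impI)
      fix I assume I: "I \<in> dom (F j)" "the (F j I) + y (I + J) \<noteq> \<infinity>"
      then obtain Q where Q: "Q \<noteq> I + J" "?v Q \<le> ?v (I + J)" using L v by metis
      then have "?v Q \<noteq> \<infinity>" using I v by force
      then obtain I' where "I' \<in> dom (F j)" "Q = I' + J" using supp by blast
      then show "\<exists>I'\<in>dom (F j). I' \<noteq> I \<and> the (F j I') + y (I' + J) \<le> the (F j I) + y (I + J)"
        using Q v I(1) by metis
    qed
  next
    assume R: ?R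
    show "\<forall>P. ?v P \<noteq> \<infinity> \<longrightarrow> (\<exists>Q. Q \<noteq> P \<and> ?v Q \<le> ?v P)"
    proof (intro allI impI)
      fix P assume P: "?v P \<noteq> \<infinity>"
      then obtain I where I: "I \<in> dom (F j)" "P = I + J" using supp by blast
      then obtain I' where "I' \<in> dom (F j)" "I' \<noteq> I" 
        "the (F j I') + y (I' + J) \<le> the (F j I) + y (I + J)"
        using R P v by metis
      then show "\<exists>Q. Q \<noteq> P \<and> ?v Q \<le> ?v P"
        using I v by (intro exI[of _ "I' + J"]) auto
    qed
  qed
  finally show ?thesis .
qed

lemma trop_power_add: "trop_power a (I + J) = trop_power a I + trop_power a J"
proof -
  have "ereal (real (I $ i + J $ i)) * a $ i = ereal (real (I $ i)) * a $ i + ereal (real (J $ i)) * a $ i" for i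
    using ereal_left_distrib[of "ereal (real (I $ i))" "ereal (real (J $ i))" "a $ i"] by simp
  then show ?thesis unfolding trop_power_def sum.distrib[symmetric] vector_add_component
    by (intro sum.cong refl)
qed

lemma trop_power_zero [simp]: "trop_power a 0 = 0"
  by (simp add: trop_power_def flip: zero_ereal_def)

lemma trop_power_not_MInfty:
  assumes "a \<in> trop_points trop_R_inf"
  shows "trop_power a I \<noteq> -\<infinity>"
proof -
  have "ereal (real (I $ i)) * a $ i \<noteq> -\<infinity>" for i
    using assms by (cases "a $ i") (auto simp: trop_points_def trop_R_inf_def)
  then have "(\<Sum>i\<in>B. ereal (real (I $ i)) * a $ i) \<noteq> -\<infinity>" for B
    by (induction B rule: infinite_finite_induct) auto
  then show ?thesis unfolding trop_power_def .
qed

lemma trop_power_real: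
  assumes "\<And>i. I $ i \<noteq> 0 \<Longrightarrow> a $ i = ereal (b $ i)"
  shows "trop_power a I = ereal (expo I \<bullet> b)"
proof -
  have "ereal (real (I $ i)) * a $ i = ereal (real (I $ i) * b $ i)" for i
    using assms[of i] by (cases "I $ i = 0") (auto simp flip: zero_ereal_def)
  then show ?thesis by (simp add: trop_power_def inner_vec_def)
qed

lemma trop_power_PInfty:
  assumes "a $ i = \<infinity>" "I $ i \<noteq> 0"
  shows "trop_power a I = \<infinity>"
proof -
  have "ereal (real (I $ i)) * a $ i = \<infinity>" using assms by simp
  then show ?thesis unfolding trop_power_def by (subst sum_Pinfty) auto
qed

lemma macaulay_solution_of_root:
  assumes fin: "\<And>j. j \<in> {1..k} \<Longrightarrow> finite (dom (F j))"
    and a: "a \<in> trop_points trop_R_inf" and root: "\<And>j. j \<in> {1..k} \<Longrightarrow> trop_root (F j) a"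
    and r: "r \<in> macaulay_rows k"
  shows "trop_vanishes UNIV (\<lambda>P. macaulay F r P + trop_power a P)"
proof -
  obtain j J where r_eq: "r = (j, J)" and j: "j \<in> {1..k}"
    using r by (auto simp: macaulay_rows_def)
  have eq: "the (F j I) + trop_power a (I + J) = trop_monom (F j) a I + trop_power a J" for I
    by (simp add: trop_monom_def trop_power_add add.assoc)
  have "\<exists>I'\<in>dom (F j). I' \<noteq> I \<and> trop_monom (F j) a I' + trop_power a J \<le> trop_monom (F j) a I + trop_power a J"
    if "I \<in> dom (F j)" "trop_monom (F j) a I + trop_power a J \<noteq> \<infinity>" for I
  proof -
    have "trop_monom (F j) a I \<noteq> \<infinity>" using that(2) by auto
    then show ?thesis
      using root[OF j] that(1) by (auto simp: trop_root_iff[OF fin[OF j]] intro: add_right_mono)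
  qed
  then show ?thesis
    unfolding r_eq
    by (subst macaulay_row_vanishes_iff[of F j "trop_power a" J, OF fin[OF j]])
      (auto simp: eq trop_power_not_MInfty[OF a])
qed

text \<open>
  The monomials that stay finite when the variables outside \<open>S\<close> are set to \<open>\<infinity>\<close> and those in
  \<open>S\<close> are real.
\<close>

definition restricted_dom :: "'n set \<Rightarrow> 'n::finite trop_poly \<Rightarrow> (nat ^ 'n) set"
  where "restricted_dom S f = {I \<in> dom f. the (f I) \<noteq> \<infinity> \<and> (\<forall>i. i \<notin> S \<longrightarrow> I $ i = 0)}"

text \<open>
  A polynomial without restricted monomials has value \<open>\<infinity>\<close> at every point that is \<open>\<infinity>\<close> outside
  \<open>S\<close> and so imposes no condition; the remaining polynomials are handled by the real case.  The
  bound on \<open>p0\<close> is a crude one that covers every choice of one exponent per polynomial.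
\<close>

lemma root_of_restricted_solution:
  fixes F :: "nat \<Rightarrow> 'n::finite trop_poly" and y :: "nat ^ 'n \<Rightarrow> ereal"
  assumes fin: "\<And>j. j \<in> {1..k} \<Longrightarrow> finite (dom (F j))"
    and F: "\<And>j. j \<in> {1..k} \<Longrightarrow> ran (F j) \<subseteq> trop_R_inf"
    and y: "\<And>p. y p \<noteq> -\<infinity>"
    and sol: "\<And>j I J. j \<in> {1..k} \<Longrightarrow> I \<in> restricted_dom S (F j) \<Longrightarrow> y (I + J) \<noteq> \<infinity> \<Longrightarrow>
        \<exists>I'\<in>restricted_dom S (F j). I' \<noteq> I \<and> the (F j I') + y (I' + J) \<le> the (F j I) + y (I + J)"
    and p0: "y p0 \<noteq> \<infinity>"
    and large: "\<And>i. (\<Sum>j=1..k. \<Sum>I\<in>dom (F j). I $ i) < p0 $ i"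
  shows "\<exists>b :: real ^ 'n. \<forall>j\<in>{1..k}. trop_root (F j) (\<chi> i. if i \<in> S then ereal (b $ i) else \<infinity>)"
proof -
  define s where "s j = restricted_dom S (F j)" for j
  define c where "c j I = real_of_ereal (the (F j I))" for j I
  define A where "A = {j \<in> {1..k}. s j \<noteq> {}}"
  have c: "the (F j I) = ereal (c j I)" if "j \<in> {1..k}" "I \<in> s j" for j I
    using F[OF that(1)] that(2) 
    by (cases "the (F j I)") (auto simp: s_def c_def restricted_dom_def trop_R_inf_def ran_def)
  have s: "finite (s l) \<and> s l \<noteq> {}" if "l \<in> A" for l
    using that fin[of l] by (auto simp: A_def s_def restricted_dom_def)
  have "\<forall>l\<in>A. \<exists>I. I \<in> s l" by (auto simp: A_def)
  then obtain e where e: "\<And>l. l \<in> A \<Longrightarrow> e l \<in> s l" by metis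
  have e_less: "(\<Sum>l\<in>A. e l $ i) < p0 $ i" for i
  proof -
    have "e l $ i \<le> (\<Sum>I\<in>dom (F l). I $ i)" if "l \<in> A" for l
      using e[OF that] fin[of l] that
      by (intro member_le_sum[of "e l" "dom (F l)" "\<lambda>I. I $ i"]) (auto simp: A_def s_def restricted_dom_def)
    then have "(\<Sum>l\<in>A. e l $ i) \<le> (\<Sum>l\<in>A. \<Sum>I\<in>dom (F l). I $ i)"
      by (rule sum_mono)
    also have "\<dots> \<le> (\<Sum>j=1..k. \<Sum>I\<in>dom (F j). I $ i)"
      by (intro sum_mono2) (auto simp: A_def)
    finally show ?thesis using large[of i] by linarith
  qed
  have "\<exists>b. \<forall>j\<in>A. \<forall>I\<in>s j. \<exists>I'\<in>s j. I' \<noteq> I \<and> c j I' + expo I' \<bullet> b \<le> c j I + expo I \<bullet> b"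
  proof (rule real_root_of_macaulay_solution[of A s y c p0 e])
    fix j I J assume "j \<in> A" "I \<in> s j" "y (I + J) \<noteq> \<infinity>"
    then show "\<exists>I'\<in>s j. I' \<noteq> I \<and> ereal (c j I') + y (I' + J) \<le> ereal (c j I) + y (I + J)"
      using sol[of j I J] c[of j] by (fastforce simp: A_def s_def)
  next
    show "finite A" by (simp add: A_def)
  qed (fact s y p0 e e_less)+
  then obtain b where b: "\<And>j I. j \<in> A \<Longrightarrow> I \<in> s j \<Longrightarrow>
      \<exists>I'\<in>s j. I' \<noteq> I \<and> c j I' + expo I' \<bullet> b \<le> c j I + expo I \<bullet> b"
    by blast
  let ?a = "\<chi> i. if i \<in> S then ereal (b $ i) else \<infinity>"
  have "trop_root (F j) ?a" if j: "j \<in> {1..k}" for j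
  proof -
    have monom: "trop_monom (F j) ?a I = ereal (c j I + expo I \<bullet> b)" if "I \<in> s j" for I
    proof -
      have "trop_power ?a I = ereal (expo I \<bullet> b)"
        using that by (intro trop_power_real) (auto simp: s_def restricted_dom_def)
      then show ?thesis by (simp add: trop_monom_def c[OF j that])
    qed
    have "\<exists>I'\<in>dom (F j). I' \<noteq> I \<and> trop_monom (F j) ?a I' \<le> trop_monom (F j) ?a I"
      if I: "I \<in> dom (F j)" "trop_monom (F j) ?a I \<noteq> \<infinity>" for I
    proof -
      have "trop_power ?a I \<noteq> \<infinity>" "the (F j I) \<noteq> \<infinity>" using I(2) by (auto simp: trop_monom_def)
      moreover have "I $ i = 0" if "i \<notin> S" for i
        using trop_power_PInfty[of ?a i I] \<open>trop_power ?a I \<noteq> \<infinity>\<close> that by auto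
      ultimately have Is: "I \<in> s j"
        using I(1) by (auto simp: s_def restricted_dom_def)
      then have "j \<in> A" using j by (auto simp: A_def)
      then obtain I' where "I' \<in> s j" "I' \<noteq> I" "c j I' + expo I' \<bullet> b \<le> c j I + expo I \<bullet> b"
        using b Is by blast
      moreover from this have "I' \<in> dom (F j)" by (simp add: s_def restricted_dom_def)
      ultimately show ?thesis using monom[OF Is] monom[of I'] by (intro bexI[of _ I']) auto
    qed
    then show ?thesis by (simp add: trop_root_iff[OF fin[OF j]])
  qed
  then show ?thesis by blast
qed

text \<open>
  For \<open>X\<close> the set of finite entries, \<open>S\<close> is a maximal set of directions in which \<open>X\<close> is jointly
  unbounded.  By maximality, points of \<open>X\<close> far out in the directions of \<open>S\<close> have bounded
  coordinates elsewhere, so there is a largest coordinate sum \<open>m\<close> that occurs arbitrarily far out.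
  Beyond some \<open>N\<close> no larger sum occurs: raising a coordinate outside \<open>S\<close> leads to infinite
  entries.
\<close>

lemma unbounded_stratum:
  fixes X :: "(nat ^ 'n::finite) set"
  assumes "X \<noteq> {}"
  shows "\<exists>S N m. (\<forall>M. \<exists>p\<in>X. (\<forall>i\<in>S. p $ i \<ge> M) \<and> (\<Sum>i\<in>-S. p $ i) = m)
    \<and> (\<forall>p\<in>X. (\<forall>i\<in>S. p $ i \<ge> N) \<longrightarrow> (\<Sum>i\<in>-S. p $ i) \<le> m)"
proof -
  define Q where "Q S \<longleftrightarrow> (\<forall>M. \<exists>p\<in>X. \<forall>i\<in>S. p $ i \<ge> M)" for S
  have "Q {}" using assms by (auto simp: Q_def)
  then obtain S where S: "Q S" and S_max: "\<And>S'. Q S' \<Longrightarrow> S \<subseteq> S' \<Longrightarrow> S' = S"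
    using finite_has_maximal[of "{S. Q S}"] by auto
  have "\<exists>M. \<forall>p\<in>X. (\<forall>j\<in>S. p $ j \<ge> M) \<longrightarrow> p $ i < M" if "i \<notin> S" for i
  proof -
    have "\<not> Q (insert i S)" using S_max[of "insert i S"] that by auto
    then obtain M where "\<not> (\<exists>p\<in>X. \<forall>j\<in>insert i S. p $ j \<ge> M)" unfolding Q_def by blast
    then have "\<forall>p\<in>X. (\<forall>j\<in>S. p $ j \<ge> M) \<longrightarrow> p $ i < M" using leI by blast
    then show ?thesis ..
  qed
  then obtain M where M: "\<And>i p. i \<notin> S \<Longrightarrow> p \<in> X \<Longrightarrow> (\<forall>j\<in>S. p $ j \<ge> M i) \<Longrightarrow> p $ i < M i"
    by metis
  define m where "m = (GREATEST m. \<forall>K. \<exists>p\<in>X. (\<forall>i\<in>S. p $ i \<ge> K) \<and> (\<Sum>i\<in>-S. p $ i) \<ge> m)"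
  let ?P = "\<lambda>m. \<forall>K. \<exists>p\<in>X. (\<forall>i\<in>S. p $ i \<ge> K) \<and> (\<Sum>i\<in>-S. p $ i) \<ge> m"
  have "?P 0" using S by (auto simp: Q_def)
  have bound: "m' \<le> sum M (-S)" if P: "?P m'" for m'
  proof -
    obtain p where p: "p \<in> X" "\<forall>i\<in>S. p $ i \<ge> sum M UNIV" "(\<Sum>i\<in>-S. p $ i) \<ge> m'"
      using P by blast
    have "p $ i \<le> M i" if "i \<in> -S" for i
    proof -
      have "M i \<le> sum M UNIV" by (rule member_le_sum) auto
      then show ?thesis using M[of i p] p that by force
    qed
    then have "(\<Sum>i\<in>-S. p $ i) \<le> sum M (-S)" by (rule sum_mono)
    then show ?thesis using p(3) by linarith
  qed
  have Pm: "?P m" unfolding m_def by (rule GreatestI_nat[of ?P, OF \<open>?P 0\<close> bound]) simp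
  have "\<not> ?P (Suc m)"
  proof
    assume "?P (Suc m)"
    then have "Suc m \<le> m" unfolding m_def by (rule Greatest_le_nat) (fact bound)
    then show False by simp
  qed
  then obtain N where N: "\<And>p. p \<in> X \<Longrightarrow> \<forall>i\<in>S. p $ i \<ge> N \<Longrightarrow> (\<Sum>i\<in>-S. p $ i) \<le> m"
    unfolding not_less_eq_eq[symmetric] by blast
  have "\<exists>p\<in>X. (\<forall>i\<in>S. p $ i \<ge> K) \<and> (\<Sum>i\<in>-S. p $ i) = m" for K
  proof -
    obtain p where "p \<in> X" "\<forall>i\<in>S. p $ i \<ge> max K N" "(\<Sum>i\<in>-S. p $ i) \<ge> m"
      using Pm by blast
    then show ?thesis using N[of p] by (intro bexI[of _ p]) auto
  qed
  then show ?thesis using N by blast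
qed

text \<open>
  The solution is restricted to the slice through a point \<open>u\<close> of the top stratum, made constant in
  the directions outside \<open>S\<close>, and shifted by \<open>N\<close> in those of \<open>S\<close>.  A monomial that involves
  a variable outside \<open>S\<close> moves the slice beyond the top stratum, hence to infinite entries, so it
  drops out of every row.
\<close>

lemma root_of_macaulay_solution_inf:
  fixes F :: "nat \<Rightarrow> 'n::finite trop_poly" and y :: "nat ^ 'n \<Rightarrow> ereal"
  assumes fin: "\<And>j. j \<in> {1..k} \<Longrightarrow> finite (dom (F j))"
    and F: "\<And>j. j \<in> {1..k} \<Longrightarrow> ran (F j) \<subseteq> trop_R_inf"
    and y: "\<And>p. y p \<noteq> -\<infinity>" and y0: "y p\<^sub>0 \<noteq> \<infinity>"
    and sol: "\<And>r. r \<in> macaulay_rows k \<Longrightarrow> trop_vanishes UNIV (\<lambda>P. macaulay F r P + y P)"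
  shows "\<exists>a\<in>trop_points trop_R_inf. \<forall>j\<in>{1..k}. trop_root (F j) a"
proof -
  define X where "X = {p. y p \<noteq> \<infinity>}"
  have "X \<noteq> {}" using y0 by (auto simp: X_def)
  then obtain S N m where ex: "\<And>M. \<exists>p\<in>X. (\<forall>i\<in>S. p $ i \<ge> M) \<and> (\<Sum>i\<in>-S. p $ i) = m"
    and top: "\<And>p. p \<in> X \<Longrightarrow> \<forall>i\<in>S. p $ i \<ge> N \<Longrightarrow> (\<Sum>i\<in>-S. p $ i) \<le> m"
    using unbounded_stratum[of X] by blast
  define D where "D = Suc (\<Sum>i\<in>UNIV. \<Sum>j=1..k. \<Sum>I\<in>dom (F j). I $ i)"
  have D: "(\<Sum>j=1..k. \<Sum>I\<in>dom (F j). I $ i) < D" for i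
    unfolding D_def less_Suc_eq_le
    by (rule member_le_sum[of i UNIV "\<lambda>i. \<Sum>j=1..k. \<Sum>I\<in>dom (F j). I $ i"]) auto
  obtain u where u: "u \<in> X" "\<And>i. i \<in> S \<Longrightarrow> u $ i \<ge> N + D" "(\<Sum>i\<in>-S. u $ i) = m"
    using ex[of "N + D"] by blast
  define base where "base q = (\<chi> i. if i \<in> S then q $ i + N else u $ i)" for q :: "nat ^ 'n"
  define z where "z q = y (base q)" for q
  have "\<exists>b :: real ^ 'n. \<forall>j\<in>{1..k}. trop_root (F j) (\<chi> i. if i \<in> S then ereal (b $ i) else \<infinity>)"
  proof (rule root_of_restricted_solution[of k F z S "\<chi> i. if i \<in> S then u $ i - N else D"])
    fix j I J assume j: "j \<in> {1..k}" and I: "I \<in> restricted_dom S (F j)" and fz: "z (I + J) \<noteq> \<infinity>"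
    have base_add: "base (I + J) = I + base J" if "I \<in> restricted_dom S (F j)" for I
      using that by (auto simp: base_def restricted_dom_def vec_eq_iff)
    have "trop_vanishes UNIV (\<lambda>P. macaulay F (j, base J) P + y P)"
      using sol j by (simp add: macaulay_rows_def)
    moreover have "I \<in> dom (F j)" "the (F j I) + y (I + base J) \<noteq> \<infinity>"
      using I fz base_add[OF I] by (auto simp: restricted_dom_def z_def)
    ultimately obtain I' where I': "I' \<in> dom (F j)" "I' \<noteq> I"
      and le: "the (F j I') + y (I' + base J) \<le> the (F j I) + y (I + base J)"
      unfolding macaulay_row_vanishes_iff[of F j y "base J", OF fin[OF j] y] by blast
    have "the (F j I') + y (I' + base J) \<noteq> \<infinity>"
      using le \<open>the (F j I) + y (I + base J) \<noteq> \<infinity>\<close> by auto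
    then have fI': "the (F j I') \<noteq> \<infinity>" "I' + base J \<in> X" by (auto simp: X_def)
    have "(\<Sum>i\<in>-S. (I' + base J) $ i) \<le> m"
      by (rule top[OF fI'(2)]) (auto simp: base_def)
    moreover have "(\<Sum>i\<in>-S. base J $ i) = m"
      unfolding u(3)[symmetric] by (rule sum.cong) (auto simp: base_def)
    ultimately have "(\<Sum>i\<in>-S. I' $ i) = 0" by (simp add: sum.distrib)
    then have "I' \<in> restricted_dom S (F j)"
      using I'(1) fI'(1) by (auto simp: restricted_dom_def)
    moreover have "the (F j I') + z (I' + J) \<le> the (F j I) + z (I + J)"
      if "I' \<in> restricted_dom S (F j)"
      using le unfolding z_def base_add[OF I] base_add[OF that] .
    ultimately show "\<exists>I'\<in>restricted_dom S (F j). I' \<noteq> I \<and> the (F j I') + z (I' + J) \<le> the (F j I) + z (I + J)"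
      using I'(2) by blast
  next
    have "N \<le> u $ i" if "i \<in> S" for i using u(2)[OF that] by simp
    then have "base (\<chi> i. if i \<in> S then u $ i - N else D) = u"
      by (simp add: base_def vec_eq_iff)
    then show "z (\<chi> i. if i \<in> S then u $ i - N else D) \<noteq> \<infinity>"
      using u(1) by (simp add: z_def X_def)
  next
    fix i show "(\<Sum>j=1..k. \<Sum>I\<in>dom (F j). I $ i) < (\<chi> i. if i \<in> S then u $ i - N else D) $ i"
      using D[of i] u(2)[of i] by auto
  next
    fix p show "z p \<noteq> -\<infinity>" by (simp add: z_def y)
  qed (fact fin F)+
  then obtain b :: "real ^ 'n" where
    "\<forall>j\<in>{1..k}. trop_root (F j) (\<chi> i. if i \<in> S then ereal (b $ i) else \<infinity>)" ..
  moreover have "(\<chi> i. if i \<in> S then ereal (b $ i) else \<infinity>) \<in> trop_points trop_R_inf"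
    by (simp add: trop_points_def trop_R_inf_def)
  ultimately show ?thesis by blast
qed

lemma root_of_macaulay_solution_real:
  fixes F :: "nat \<Rightarrow> 'n::finite trop_poly" and y :: "nat ^ 'n \<Rightarrow> ereal"
  assumes fin: "\<And>j. j \<in> {1..k} \<Longrightarrow> finite (dom (F j))"
    and F: "\<And>j. j \<in> {1..k} \<Longrightarrow> ran (F j) \<subseteq> trop_R"
    and y: "\<And>p. y p \<in> trop_R"
    and sol: "\<And>r. r \<in> macaulay_rows k \<Longrightarrow> trop_vanishes UNIV (\<lambda>P. macaulay F r P + y P)"
  shows "\<exists>a\<in>trop_points trop_R. \<forall>j\<in>{1..k}. trop_root (F j) a"
proof -
  have y_fin: "y p \<noteq> \<infinity>" "y p \<noteq> -\<infinity>" for p using y[of p] by (auto simp: trop_R_def)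
  have rdom: "restricted_dom UNIV (F j) = dom (F j)" if "j \<in> {1..k}" for j
    using F[OF that] by (force simp: restricted_dom_def trop_R_def ran_def)
  have coeff_fin: "the (F j I) \<noteq> \<infinity>" if "j \<in> {1..k}" "I \<in> dom (F j)" for j I
    using that rdom by (auto simp: restricted_dom_def)
  have "\<exists>b :: real ^ 'n. \<forall>j\<in>{1..k}. trop_root (F j) (\<chi> i. if i \<in> UNIV then ereal (b $ i) else \<infinity>)"
  proof (rule root_of_restricted_solution[of k F y UNIV "\<chi> i. Suc (\<Sum>j=1..k. \<Sum>I\<in>dom (F j). I $ i)"])
    fix j I J assume j: "j \<in> {1..k}" and I: "I \<in> restricted_dom UNIV (F j)"
    have "trop_vanishes UNIV (\<lambda>P. macaulay F (j, J) P + y P)"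
      using sol j by (simp add: macaulay_rows_def)
    then show "\<exists>I'\<in>restricted_dom UNIV (F j). I' \<noteq> I \<and> the (F j I') + y (I' + J) \<le> the (F j I) + y (I + J)"
      using I y_fin coeff_fin[OF j]
      unfolding macaulay_row_vanishes_iff[of F j y J, OF fin[OF j] y_fin(2)] rdom[OF j] by simp
  next
    fix j assume "j \<in> {1..k}"
    then show "ran (F j) \<subseteq> trop_R_inf" using F by (fastforce simp: trop_R_def trop_R_inf_def)
  qed (fact fin y_fin | simp)+
  then obtain b :: "real ^ 'n" where "\<forall>j\<in>{1..k}. trop_root (F j) (\<chi> i. ereal (b $ i))" by auto
  moreover have "(\<chi> i. ereal (b $ i)) \<in> trop_points trop_R"
    by (simp add: trop_points_def trop_R_def)
  ultimately show ?thesis by blast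
qed

theorem corollary5:
  fixes F :: "nat \<Rightarrow> 'n::finite trop_poly" and k :: nat
  shows "((\<forall>j\<in>{1..k}. is_trop_poly trop_R (F j)) \<longrightarrow>
           ((\<exists>a\<in>trop_points trop_R. \<forall>j\<in>{1..k}. trop_root (F j) a) \<longleftrightarrow>
            (\<exists>y. trop_linear_solution trop_R (macaulay_rows k) (macaulay F) y)))
       \<and> ((\<forall>j\<in>{1..k}. is_trop_poly trop_R_inf (F j)) \<longrightarrow>
           ((\<exists>a\<in>trop_points trop_R_inf. \<forall>j\<in>{1..k}. trop_root (F j) a) \<longleftrightarrow>
            (\<exists>y. trop_linear_solution trop_R_inf (macaulay_rows k) (macaulay F) y \<and> y 0 = 0)))"
proof (intro conjI impI iffI)
  assume F: "\<forall>j\<in>{1..k}. is_trop_poly trop_R (F j)"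
    and "\<exists>a\<in>trop_points trop_R. \<forall>j\<in>{1..k}. trop_root (F j) a"
  then obtain a where a: "a \<in> trop_points trop_R" "\<And>j. j \<in> {1..k} \<Longrightarrow> trop_root (F j) a" by blast
  define b :: "real ^ 'n" where "b = (\<chi> i. real_of_ereal (a $ i))"
  have b: "a $ i = ereal (b $ i)" for i
  proof -
    have "a $ i \<in> range ereal" using a(1) by (simp add: trop_points_def trop_R_def)
    then obtain x where "a $ i = ereal x" by blast
    then show ?thesis by (simp add: b_def)
  qed
  have "trop_power a I \<in> trop_R" for I using trop_power_real[of I a b] b by (simp add: trop_R_def)
  moreover have "a \<in> trop_points trop_R_inf" using b by (simp add: trop_points_def trop_R_inf_def)
  ultimately have "trop_linear_solution trop_R (macaulay_rows k) (macaulay F) (trop_power a)"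
    using macaulay_solution_of_root[of k F a] F a(2)
    by (auto simp: trop_linear_solution_def is_trop_poly_def)
  then show "\<exists>y. trop_linear_solution trop_R (macaulay_rows k) (macaulay F) y" by blast
next
  assume F: "\<forall>j\<in>{1..k}. is_trop_poly trop_R (F j)"
    and "\<exists>y. trop_linear_solution trop_R (macaulay_rows k) (macaulay F) y"
  then obtain y where "trop_linear_solution trop_R (macaulay_rows k) (macaulay F) y" by blast
  then show "\<exists>a\<in>trop_points trop_R. \<forall>j\<in>{1..k}. trop_root (F j) a"
    using F by (intro root_of_macaulay_solution_real[of k F y])
      (auto simp: trop_linear_solution_def is_trop_poly_def)
next
  assume F: "\<forall>j\<in>{1..k}. is_trop_poly trop_R_inf (F j)"
    and "\<exists>a\<in>trop_points trop_R_inf. \<forall>j\<in>{1..k}. trop_root (F j) a"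
  then obtain a where a: "a \<in> trop_points trop_R_inf" "\<And>j. j \<in> {1..k} \<Longrightarrow> trop_root (F j) a" by blast
  have "trop_linear_solution trop_R_inf (macaulay_rows k) (macaulay F) (trop_power a)"
    using macaulay_solution_of_root[of k F a] F a trop_power_not_MInfty[OF a(1)]
    by (auto simp: trop_linear_solution_def is_trop_poly_def trop_R_inf_def)
  then show "\<exists>y. trop_linear_solution trop_R_inf (macaulay_rows k) (macaulay F) y \<and> y 0 = 0"
    using trop_power_zero by blast
next
  assume F: "\<forall>j\<in>{1..k}. is_trop_poly trop_R_inf (F j)"
    and "\<exists>y. trop_linear_solution trop_R_inf (macaulay_rows k) (macaulay F) y \<and> y 0 = 0"
  then obtain y where "trop_linear_solution trop_R_inf (macaulay_rows k) (macaulay F) y" "y 0 = 0" by blast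
  then show "\<exists>a\<in>trop_points trop_R_inf. \<forall>j\<in>{1..k}. trop_root (F j) a"
    using F by (intro root_of_macaulay_solution_inf[of k F y 0])
      (auto simp: trop_linear_solution_def is_trop_poly_def trop_R_inf_def)
qed

end
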